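(* Let $a>0$ and $0<b<\frac12$, and for $F_x,F_y\in\mathbb{R}$ let $V_F:\mathbb{R}^2\to\mathbb{R}$ be $$V_F(x,y)=\frac14 r^4-\frac12 r^2-ax^2+by^2+F_x x+F_y y,\qquad r=\sqrt{x^2+y^2}.$$ (i) Let $F_x>0$ and $F_y=0$, and let $F_x$ be bounded by $F_x^{sad}$ and $F_x^{crit}$, i.e. $F_x<F_x^{sad}$ and $F_x<F_x^{crit}$, where $$F_x^{sad}=2(a+b)\sqrt{1-2b},\qquad F_x^{crit}=\sqrt{\frac{4(1+2a)^3}{27}}.$$ Then $V_F$ has five critical points. (ii) Let $F_x=0$ and $F_y>0$, and let $F_y$ be bounded by $F_y^{sad}$ and $F_y^{crit}$, i.e. $F_y<F_y^{sad}$ and $F_y<F_y^{crit}$, where $$F_y^{sad}=2(a+b)\sqrt{1+2a},\qquad F_y^{crit}=\sqrt{\frac{4(1-2b)^3}{27}}.$$ Then $V_F$ has five critical points.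
   Context: A critical point of $V_F$ is a point $(x,y)\in\mathbb{R}^2$ at which $\frac{\partial V_F}{\partial x}=0$ and $\frac{\partial V_F}{\partial y}=0$. "Has five critical points" means exactly five distinct critical points. *)

theory Defs
  imports Complex_Main
begin

definition V :: "real \<Rightarrow> real \<Rightarrow> real \<Rightarrow> real \<Rightarrow> real \<times> real \<Rightarrow> real" where
  "V a b Fx Fy = (\<lambda>(x, y). let r = sqrt (x\<^sup>2 + y\<^sup>2) in
     1/4 * r ^ 4 - 1/2 * r\<^sup>2 - a * x\<^sup>2 + b * y\<^sup>2 + Fx * x + Fy * y)"

text \<open>The partial derivatives are required to exist and to vanish; \<open>deriv\<close> would be
  unspecified at points where they fail to exist.\<close>

definition critical_point :: "(real \<times> real \<Rightarrow> real) \<Rightarrow> real \<times> real \<Rightarrow> bool" where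
  "critical_point f p \<longleftrightarrow>
     ((\<lambda>x. f (x, snd p)) has_real_derivative 0) (at (fst p)) \<and>
     ((\<lambda>y. f (fst p, y)) has_real_derivative 0) (at (snd p))"

definition Fx_sad :: "real \<Rightarrow> real \<Rightarrow> real" where
  "Fx_sad a b = 2 * (a + b) * sqrt (1 - 2 * b)"

definition Fx_crit :: "real \<Rightarrow> real" where
  "Fx_crit a = sqrt (4 * (1 + 2 * a) ^ 3 / 27)"

definition Fy_sad :: "real \<Rightarrow> real \<Rightarrow> real" where
  "Fy_sad a b = 2 * (a + b) * sqrt (1 + 2 * a)"

definition Fy_crit :: "real \<Rightarrow> real" where
  "Fy_crit b = sqrt (4 * (1 - 2 * b) ^ 3 / 27)"

end

theory Submission
  imports Defs
begin

text \<open>The critical point equations are \<open>x r\<^sup>2 - (1 + 2a) x + F\<^sub>x = 0\<close> and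
  \<open>y r\<^sup>2 - (1 - 2b) y + F\<^sub>y = 0\<close>. If the force points along one axis, the other equation factors:
  either the transversal coordinate vanishes, which leaves a depressed cubic with three real roots as
  long as the force is below the critical value, or \<open>r\<^sup>2\<close> is the transversal coefficient,
  which leaves a line meeting this circle in two points as long as the force is below the saddle
  value.\<close>

text \<open>Uniqueness of derivatives turns the condition that a derivative is \<open>0\<close> into
  an equation for a derivative already computed.\<close>

lemma has_real_derivative_eq_iff:
  assumes "(f has_real_derivative D) (at x)"
  shows "(f has_real_derivative E) (at x) \<longleftrightarrow> D = E"
  using assms DERIV_unique by blast

lemma critical_point_V_iff:
  "critical_point (V a b Fx Fy) (x, y) \<longleftrightarrow>
     x * (x\<^sup>2 + y\<^sup>2) - (1 + 2 * a) * x + Fx = 0 \<and>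
     y * (x\<^sup>2 + y\<^sup>2) - (1 - 2 * b) * y + Fy = 0"
proof -
  \<comment> \<open>Only even powers of the radius occur, so the square root disappears and
    differentiation also works at the origin.\<close>
  have V_eq: "V a b Fx Fy (u, v) =
      1/4 * (u\<^sup>2 + v\<^sup>2)\<^sup>2 - 1/2 * (u\<^sup>2 + v\<^sup>2) - a * u\<^sup>2 + b * v\<^sup>2 + Fx * u + Fy * v" for u v
  proof -
    have "sqrt (u\<^sup>2 + v\<^sup>2) ^ 4 = (u\<^sup>2 + v\<^sup>2)\<^sup>2"
      using power_mult[of "sqrt (u\<^sup>2 + v\<^sup>2)" 2 2] by simp
    then show ?thesis by (simp add: V_def Let_def)
  qed
  have dx: "((\<lambda>u. V a b Fx Fy (u, y)) has_real_derivative
      x * (x\<^sup>2 + y\<^sup>2) - (1 + 2 * a) * x + Fx) (at x)"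
    unfolding V_eq by (rule derivative_eq_intros refl | simp add: field_simps)+
  have dy: "((\<lambda>v. V a b Fx Fy (x, v)) has_real_derivative
      y * (x\<^sup>2 + y\<^sup>2) - (1 - 2 * b) * y + Fy) (at y)"
    unfolding V_eq by (rule derivative_eq_intros refl | simp add: field_simps)+
  show ?thesis
    unfolding critical_point_def fst_conv snd_conv
    by (simp only: has_real_derivative_eq_iff[OF dx] has_real_derivative_eq_iff[OF dy])
qed

lemma card_depressed_cubic_roots:
  fixes P F :: real
  assumes "P > 0" "F > 0" "F < sqrt (4 * P ^ 3 / 27)"
  shows "card {x. x ^ 3 - P * x + F = 0} = 3"
proof -
  \<comment> \<open>The cubic has its local extrema at \<open>- s\<close> and \<open>s\<close>, with
    values \<open>F + 2 * s ^ 3\<close> and \<open>F - 2 * s ^ 3\<close>. The points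
    \<open>2 * s\<close> and \<open>- 2 * s\<close> repeat these values, which yields three sign
    changes.\<close>
  define s where "s = sqrt (P / 3)"
  define g where "g x = x ^ 3 - P * x + F" for x
  have s: "s > 0" and P: "P = 3 * s\<^sup>2"
    using assms(1) by (auto simp: s_def)
  have "4 * P ^ 3 / 27 = (2 * s ^ 3)\<^sup>2"
    unfolding P by (simp add: power_mult_distrib flip: power_mult)
  then have "sqrt (4 * P ^ 3 / 27) = 2 * s ^ 3"
    using s by (simp only: real_sqrt_abs) simp
  then have F: "F < 2 * s ^ 3"
    using assms(3) by simp
  have s3: "s ^ 3 > 0" using s by simp
  have g_vals: "g (- 2 * s) < 0" "g (- s) > 0" "g s < 0" "g (2 * s) > 0"
    using F s3 assms(2)
    by (simp_all add: g_def P power2_eq_square power3_eq_cube algebra_simps)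
  have cont: "continuous_on A g" for A
    unfolding g_def by (intro continuous_intros)
  obtain x1 where x1: "x1 \<le> - s" "g x1 = 0"
    using IVT'[of g "- 2 * s" 0 "- s"] g_vals s cont by force
  obtain x2 where x2: "- s \<le> x2" "x2 \<le> s" "g x2 = 0"
    using IVT2'[of g s 0 "- s"] g_vals s cont by force
  obtain x3 where x3: "s \<le> x3" "g x3 = 0"
    using IVT'[of g s 0 "2 * s"] g_vals s cont by force
  have "x2 \<noteq> - s" "x2 \<noteq> s"
    using g_vals x2 by auto
  then have neq: "x1 \<noteq> x2" "x1 \<noteq> x3" "x2 \<noteq> x3"
    using x1 x2 x3 s by auto
  \<comment> \<open>Vieta: the cubic has no quadratic term, so three distinct roots sum to zero and
    two of them determine the third.\<close>
  have third: "z = - u - v" if "g u = 0" "g v = 0" "g z = 0" "u \<noteq> v" "u \<noteq> z" "v \<noteq> z" for u v z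
  proof -
    have quot: "w\<^sup>2 + w * u + u\<^sup>2 = P" if "g w = 0" "w \<noteq> u" for w
    proof -
      have "(w - u) * (w\<^sup>2 + w * u + u\<^sup>2 - P) = g w - g u"
        by (simp add: g_def power2_eq_square power3_eq_cube algebra_simps)
      then show ?thesis using that \<open>g u = 0\<close> by simp
    qed
    have "(z - v) * (z + u + v) = (z\<^sup>2 + z * u + u\<^sup>2) - (v\<^sup>2 + v * u + u\<^sup>2)"
      by (simp add: power2_eq_square algebra_simps)
    then have "(z - v) * (z + u + v) = 0"
      using quot[of z] quot[of v] that by simp
    then show ?thesis using that by simp
  qed
  have "x \<in> {x1, x2, x3}" if "g x = 0" for x
    using third[of x1 x2 x] third[of x1 x2 x3] that x1 x2 x3 neq by auto
  then have "{x. g x = 0} = {x1, x2, x3}"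
    using x1 x2 x3 by auto
  then show ?thesis using neq by (simp add: g_def)
qed

text \<open>\<open>P\<close> belongs to the axis of the force and \<open>Q\<close> to the
  transversal one. No order between them is assumed, so both force directions are covered.\<close>

lemma card_axial_critical_points:
  fixes P Q F :: real
  assumes "P > 0" "Q > 0" "P \<noteq> Q" "F > 0"
    and sad: "F < \<bar>P - Q\<bar> * sqrt Q" and crit: "F < sqrt (4 * P ^ 3 / 27)"
  shows "card {(x, y). x * (x\<^sup>2 + y\<^sup>2) - P * x + F = 0 \<and> y * (x\<^sup>2 + y\<^sup>2) - Q * y = 0} = 5"
    (is "card ?S = 5")
proof -
  define x0 where "x0 = F / (P - Q)"
  define y0 where "y0 = sqrt (Q - x0\<^sup>2)"
  define R where "R = {x. x ^ 3 - P * x + F = 0}"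
  \<comment> \<open>The saddle bound says exactly that the line \<open>x = x0\<close> cuts the
    circle of radius \<open>sqrt Q\<close> in two points.\<close>
  have "\<bar>x0\<bar> < sqrt Q"
    using sad assms by (simp add: x0_def abs_divide field_simps)
  then have "\<bar>x0\<bar>\<^sup>2 < (sqrt Q)\<^sup>2"
    by (intro power_strict_mono) auto
  then have x0: "x0\<^sup>2 < Q"
    using assms(2) by simp
  then have y0: "y0 > 0" "y0\<^sup>2 = Q - x0\<^sup>2"
    by (simp_all add: y0_def)
  have card_R: "card R = 3"
    unfolding R_def using assms by (intro card_depressed_cubic_roots) auto
  then have "finite R" using card.infinite by fastforce
  \<comment> \<open>On that circle the first equation becomes linear in \<open>x\<close>.\<close>
  have line: "x * Q - P * x + F = 0 \<longleftrightarrow> x = x0" for x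
    using assms(3) by (auto simp: x0_def field_simps)
  have "(x, y) \<in> ?S \<longleftrightarrow> (x, y) \<in> R \<times> {0} \<union> {(x0, y0), (x0, - y0)}" for x y
  proof (cases "y = 0")
    case True
    then show ?thesis
      using y0 by (auto simp: R_def power2_eq_square power3_eq_cube)
  next
    case False
    have "y * (x\<^sup>2 + y\<^sup>2) - Q * y = 0 \<longleftrightarrow> x\<^sup>2 + y\<^sup>2 = Q"
    proof -
      have "y * (x\<^sup>2 + y\<^sup>2) - Q * y = y * (x\<^sup>2 + y\<^sup>2 - Q)" by (simp add: algebra_simps)
      then show ?thesis using False by simp
    qed
    then have "(x, y) \<in> ?S \<longleftrightarrow> x = x0 \<and> y\<^sup>2 = y0\<^sup>2"
      using line[of x] y0 by auto
    then show ?thesis using False by (auto simp: power2_eq_iff)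
  qed
  then have "?S = R \<times> {0} \<union> {(x0, y0), (x0, - y0)}"
    by (intro set_eqI) (auto split: prod.splits)
  also have "card \<dots> = card (R \<times> {0::real}) + card {(x0, y0), (x0, - y0)}"
    using \<open>finite R\<close> y0 by (intro card_Un_disjoint) auto
  also have "\<dots> = 5"
    using card_R y0 by (simp add: card_cartesian_product)
  finally show ?thesis .
qed

lemma card_critical_points_x_force:
  fixes a b F :: real
  assumes "a > 0" "0 < b" "b < 1/2" "F > 0" "F < Fx_sad a b" "F < Fx_crit a"
  shows "card {p. critical_point (V a b F 0) p} = 5"
proof -
  have "{p. critical_point (V a b F 0) p} =
      {(x, y). x * (x\<^sup>2 + y\<^sup>2) - (1 + 2 * a) * x + F = 0 \<and> y * (x\<^sup>2 + y\<^sup>2) - (1 - 2 * b) * y = 0}"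
    by (auto simp: critical_point_V_iff)
  \<comment> \<open>Here \<open>P - Q\<close> is \<open>2 * (a + b)\<close>.\<close>
  moreover have "F < \<bar>1 + 2 * a - (1 - 2 * b)\<bar> * sqrt (1 - 2 * b)"
    using assms by (simp add: Fx_sad_def distrib_left)
  ultimately show ?thesis
    using assms card_axial_critical_points[of "1 + 2 * a" "1 - 2 * b" F] by (simp add: Fx_crit_def)
qed

lemma card_critical_points_y_force:
  fixes a b F :: real
  assumes "a > 0" "0 < b" "b < 1/2" "F > 0" "F < Fy_sad a b" "F < Fy_crit b"
  shows "card {p. critical_point (V a b 0 F) p} = 5"
proof -
  \<comment> \<open>Swapping the coordinates puts the force on the first axis; now
    \<open>P - Q\<close> is negative, hence the absolute value in the saddle bound.\<close>
  let ?S = "{(y, x). y * (y\<^sup>2 + x\<^sup>2) - (1 - 2 * b) * y + F = 0 \<and>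
    x * (y\<^sup>2 + x\<^sup>2) - (1 + 2 * a) * x = 0}"
  have "{p. critical_point (V a b 0 F) p} = prod.swap ` ?S"
    by (auto simp: critical_point_V_iff image_iff add.commute)
  then have "card {p. critical_point (V a b 0 F) p} = card ?S"
    by (simp add: card_image)
  moreover have "F < \<bar>1 - 2 * b - (1 + 2 * a)\<bar> * sqrt (1 + 2 * a)"
    using assms by (simp add: Fy_sad_def distrib_left)
  ultimately show ?thesis
    using assms card_axial_critical_points[of "1 - 2 * b" "1 + 2 * a" F] by (simp add: Fy_crit_def)
qed

theorem theorem4p1:
  fixes a b :: real
  assumes "a > 0" and "0 < b" and "b < 1/2"
  shows "(\<forall>Fx Fy :: real. Fx > 0 \<and> Fy = 0 \<and> Fx < Fx_sad a b \<and> Fx < Fx_crit a \<longrightarrow>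
            card {p. critical_point (V a b Fx Fy) p} = 5) \<and>
         (\<forall>Fx Fy :: real. Fx = 0 \<and> Fy > 0 \<and> Fy < Fy_sad a b \<and> Fy < Fy_crit b \<longrightarrow>
            card {p. critical_point (V a b Fx Fy) p} = 5)"
  using card_critical_points_x_force[OF assms] card_critical_points_y_force[OF assms] by blast

end
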